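(* Let $K:\mathbb{S}^2\times\mathbb{S}^2\to\mathbb{C}$ be a continuous and Hermitian kernel of the form $$K(\xi,\zeta)=\sum_{j=0}^{\infty}\sum_{k=-j}^{j}\sum_{k'=-j}^{j}d_j(k,k')\,Y_j^k(\xi)\overline{Y_j^{k'}(\zeta)},\qquad\forall\,\xi,\zeta\in\mathbb{S}^2,$$ with coefficients $d_j(k,k')\in\mathbb{C}$. For each $j$ let $D_j:\mathbb{C}^{2j+1}\to\mathbb{C}^{2j+1}$ be the linear operator $$D_j(x)=\left(\sum_{k=1}^{2j+1}d_j(k-j-1,k'-j-1)\,x_k\right)_{k'=1}^{2j+1}.$$ Then $K$ is positive definite on $\mathbb{S}^2$ if and only if $D_j$ is a positive operator for all $j\in\mathbb{N}=\{0,1,2,\dots\}$.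
   Context: $\mathbb{S}^2$ is the unit sphere in $\mathbb{R}^3$. With colatitude $\theta$ and longitude $\varphi$, the spherical harmonics are $Y_j^k(\theta,\varphi)=\frac{1}{\sqrt{2\pi}}\sqrt{\frac{2j+1}{2}\frac{(j-k)!}{(j+k)!}}\,P_{j,k}(\cos\theta)e^{ik\varphi}$, $j\ge0$, $-j\le k\le j$, where $P_{j,k}$ are the associated Legendre polynomials; they form an orthonormal basis of $L^2(\mathbb{S}^2)$ (complex-valued functions, surface measure). Writing the general expansion $K(\xi,\zeta)=\sum_{j,j'}\sum_{k,k'}\alpha_{j,j',k,k'}Y_j^k(\xi)\overline{Y_{j'}^{k'}(\zeta)}$ with $L^2(\mathbb{S}^2\times\mathbb{S}^2)$ coefficients $\alpha_{j,j',k,k'}$, the assumed form means $\alpha_{j,j',k,k'}=d_j(k,k')\delta_{j,j'}$ and that the series converges to $K$ at every point. Hermitian: $K(\xi,\zeta)=\overline{K(\zeta,\xi)}$. A linear continuous operator $P$ on a complex Hilbert space $H$ is positive if it is self-adjoint and $\langle P(x),x\rangle\ge0$ for all $x\in H$. A Hermitian kernel $K$ is positive definite on $\mathbb{S}^2$ if for every finite set $\Xi\subset\mathbb{S}^2$ of distinct points the matrix $(K(\xi,\zeta))_{\xi,\zeta\in\Xi}$ induces, by left multiplication, a positive operator on $\mathbb{C}^{|\Xi|}$. *)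

theory Defs
  imports
    "HOL-Analysis.Analysis"
    "HOL-Computational_Algebra.Polynomial"
    "Jordan_Normal_Form.Matrix"
begin

unbundle no vec_syntax

abbreviation S2 :: "(real^3) set"
  where "S2 \<equiv> sphere 0 1"


subsection \<open>Spherical coordinates and surface measure\<close>

definition spherical_point :: "real \<times> real \<Rightarrow> real^3"
  where "spherical_point = (\<lambda>(\<theta>, \<phi>). vector [sin \<theta> * cos \<phi>, sin \<theta> * sin \<phi>, cos \<theta>])"

definition colatitude :: "real^3 \<Rightarrow> real"
  where "colatitude \<xi> = arccos (vec_nth \<xi> 3)"

text \<open>
  \<^const>\<open>Arg\<close> takes values in \<open>(-\<pi>, \<pi>]\<close>; the choice of branch is irrelevant, since the longitude
  is only used through \<open>exp (\<i> k \<phi>)\<close> with integer \<open>k\<close>. At the two poles it is \<open>Arg 0 = 0\<close>, which is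
  irrelevant too, because there the harmonics of order \<open>k \<noteq> 0\<close> vanish.
\<close>

definition longitude :: "real^3 \<Rightarrow> real"
  where "longitude \<xi> = Arg (Complex (vec_nth \<xi> 1) (vec_nth \<xi> 2))"

text \<open>
  The measure with area element \<open>sin \<theta> d\<theta> d\<phi>\<close>. Its total mass is \<open>4\<pi>\<close>. It lives on the Borel sets of
  the sphere rather than of the whole space, so that measurability of a function does not depend on
  its values off the sphere.
\<close>

definition surface_measure :: "(real^3) measure"
  where "surface_measure =
    distr
      (density lborel
        (\<lambda>(\<theta>, \<phi>). ennreal (sin \<theta>) * indicator ({0..pi} \<times> {0..2 * pi}) (\<theta>, \<phi>)))
      (restrict_space borel S2)
      spherical_point"


subsection \<open>Spherical harmonics\<close>

text \<open>Rodrigues' formula: \<open>P\<^sub>j(x) = 1 / (2\<^sup>j j!) d\<^sup>j/dx\<^sup>j (x\<^sup>2 - 1)\<^sup>j\<close>.\<close>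

definition legendre_poly :: "nat \<Rightarrow> real poly"
  where "legendre_poly j = Polynomial.smult (1 / (2 ^ j * fact j)) ((pderiv ^^ j) ([:-1, 0, 1:] ^ j))"

text \<open>
  \<open>P\<^sub>j\<^sub>,\<^sub>m(x) = (-1)\<^sup>m (1 - x\<^sup>2)\<^bsup>m/2\<^esup> P\<^sub>j\<^bsup>(m)\<^esup>(x)\<close> and \<open>P\<^sub>j\<^sub>,\<^sub>-\<^sub>m = (-1)\<^sup>m (j-m)!/(j+m)! P\<^sub>j\<^sub>,\<^sub>m\<close> for \<open>0 \<le> m \<le> j\<close>,
  with the Condon--Shortley phase \<open>(-1)\<^sup>m\<close>. The power of \<open>1 - x\<^sup>2\<close> is written as a natural power of a
  square root because \<open>0 powr 0 = 0\<close>.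
\<close>

definition assoc_legendre :: "nat \<Rightarrow> int \<Rightarrow> real \<Rightarrow> real"
  where "assoc_legendre j k x =
    (let m = nat \<bar>k\<bar>;
         p = (-1) ^ m * sqrt (1 - x\<^sup>2) ^ m * poly ((pderiv ^^ m) (legendre_poly j)) x
     in if 0 \<le> k then p else (-1) ^ m * (fact (j - m) / fact (j + m)) * p)"

definition spherical_harmonic :: "nat \<Rightarrow> int \<Rightarrow> real^3 \<Rightarrow> complex"
  where "spherical_harmonic j k \<xi> =
    complex_of_real
      (1 / sqrt (2 * pi) *
       sqrt ((2 * real j + 1) / 2 * (fact (nat (int j - k)) / fact (nat (int j + k)))) *
       assoc_legendre j k (cos (colatitude \<xi>))) *
    exp (\<i> * of_int k * complex_of_real (longitude \<xi>))"

text \<open>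
  The inner product in \<open>L\<^sup>2(S\<^sup>2 \<times> S\<^sup>2)\<close> of \<open>K\<close> with the basis function
  \<open>(\<xi>, \<zeta>) \<mapsto> Y\<^sub>j\<^bsup>k\<^esup>(\<xi>) cnj (Y\<^sub>j\<^sub>'\<^bsup>k'\<^esup>(\<zeta>))\<close>.
\<close>

definition kernel_coeff ::
  "(real^3 \<Rightarrow> real^3 \<Rightarrow> complex) \<Rightarrow> nat \<Rightarrow> nat \<Rightarrow> int \<Rightarrow> int \<Rightarrow> complex"
  where "kernel_coeff K j j' k k' =
    (LINT (\<xi>, \<zeta>) | (surface_measure \<Otimes>\<^sub>M surface_measure).
       K \<xi> \<zeta> * cnj (spherical_harmonic j k \<xi> * cnj (spherical_harmonic j' k' \<zeta>)))"


subsection \<open>Positive operators and positive definite kernels\<close>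

text \<open>
  \<open>v \<bullet>c w\<close> is the inner product of \<open>\<complex>\<^sup>n\<close>, linear in the first argument. The fourth conjunct is
  continuity of the linear map, stated as boundedness with respect to the Euclidean norm. In the
  last one, \<open>0 \<le> z\<close> for a complex number \<open>z\<close> means that \<open>z\<close> is real and nonnegative.
\<close>

definition positive_operator :: "nat \<Rightarrow> (complex Matrix.vec \<Rightarrow> complex Matrix.vec) \<Rightarrow> bool"
  where "positive_operator n P \<longleftrightarrow>
    P \<in> carrier_vec n \<rightarrow> carrier_vec n \<and>
    (\<forall>x\<in>carrier_vec n. \<forall>y\<in>carrier_vec n. P (x + y) = P x + P y) \<and>
    (\<forall>c. \<forall>x\<in>carrier_vec n. P (c \<cdot>\<^sub>v x) = c \<cdot>\<^sub>v P x) \<and>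
    (\<exists>B::real. \<forall>x\<in>carrier_vec n. Re (P x \<bullet>c P x) \<le> B * Re (x \<bullet>c x)) \<and>
    (\<forall>x\<in>carrier_vec n. \<forall>y\<in>carrier_vec n. P x \<bullet>c y = x \<bullet>c P y) \<and>
    (\<forall>x\<in>carrier_vec n. 0 \<le> P x \<bullet>c x)"

definition hermitian_kernel_on :: "'a set \<Rightarrow> ('a \<Rightarrow> 'a \<Rightarrow> complex) \<Rightarrow> bool"
  where "hermitian_kernel_on S K \<longleftrightarrow> (\<forall>\<xi>\<in>S. \<forall>\<zeta>\<in>S. K \<xi> \<zeta> = cnj (K \<zeta> \<xi>))"

definition kernel_matrix :: "('a \<Rightarrow> 'a \<Rightarrow> complex) \<Rightarrow> 'a list \<Rightarrow> complex Matrix.mat"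
  where "kernel_matrix K \<Xi> = Matrix.mat (length \<Xi>) (length \<Xi>) (\<lambda>(a, b). K (\<Xi> ! a) (\<Xi> ! b))"

text \<open>A finite set of points is given by an enumeration of it without repetitions.\<close>

definition positive_definite_on :: "'a set \<Rightarrow> ('a \<Rightarrow> 'a \<Rightarrow> complex) \<Rightarrow> bool"
  where "positive_definite_on S K \<longleftrightarrow>
    hermitian_kernel_on S K \<and>
    (\<forall>\<Xi>. distinct \<Xi> \<and> set \<Xi> \<subseteq> S \<longrightarrow>
      positive_operator (length \<Xi>) (\<lambda>c. kernel_matrix K \<Xi> *\<^sub>v c))"

text \<open>Vector entries are indexed from \<open>0\<close>, hence the shift by \<open>j\<close> instead of \<open>j + 1\<close>.\<close>

definition block_operator ::
  "(nat \<Rightarrow> int \<Rightarrow> int \<Rightarrow> complex) \<Rightarrow> nat \<Rightarrow> complex Matrix.vec \<Rightarrow> complex Matrix.vec"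
  where "block_operator d j x =
    Matrix.vec (2 * j + 1)
      (\<lambda>k'. \<Sum>k<2 * j + 1. d j (int k - int j) (int k' - int j) * x $ k)"

end

theory Submission
  imports Defs
begin

text \<open>
  Over \<open>\<complex>\<close> an operator is positive as soon as its quadratic form takes nonnegative values, because
  polarization makes it self-adjoint (\<open>positive_operator_iff_form_nonneg\<close>). So the theorem compares
  two families of forms: \<open>\<Sum> K(a,b) c\<^sub>b cnj(c\<^sub>a)\<close> over finite sets of points, and
  \<open>\<Sum> d\<^sub>j(k,k') x\<^sub>k cnj(x\<^sub>k\<^sub>')\<close> for each degree \<open>j\<close>. Each kind is obtained from the other by a limit.

  From the blocks to the kernel: inserting the pointwise series of \<open>K\<close> into the form of \<open>K\<close> and
  collecting the points, degree \<open>j\<close> contributes exactly the block form at the vector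
  \<open>x\<^sub>k = \<Sum>\<^sub>a cnj(c\<^sub>a) Y\<^sub>j\<^sup>k(a)\<close> (\<open>form_sums_block_forms\<close>). A convergent series of nonnegative numbers
  has a nonnegative sum.

  From the kernel to the blocks: since \<open>d\<^sub>j(k,k')\<close> is an integral of \<open>K\<close> against harmonics, the block
  form at \<open>x\<close> is the double integral of \<open>K(\<xi>,\<zeta>) cnj(f(\<xi>)) f(\<zeta>)\<close> with \<open>f = \<Sum>\<^sub>k cnj(x\<^sub>k) Y\<^sub>j\<^sup>k\<close>
  (\<open>block_form_eq_integral\<close>). Such an integral is a limit of finite forms of \<open>K\<close>: the sphere is compact,
  so both arguments of the continuous kernel can be rounded to a finite net, the rounded integral is
  the form of \<open>K\<close> on that net with the integrals of \<open>f\<close> over the cells as coefficients, and it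
  converges to the true one as the net is refined (\<open>form_integral_nonneg\<close>).
\<close>

section \<open>Positivity as nonnegativity of Hermitian forms\<close>

lemma tendsto_nonneg_complex:
  fixes X :: "nat \<Rightarrow> complex"
  assumes "X \<longlonglongrightarrow> L" and "\<And>n. 0 \<le> X n"
  shows "0 \<le> L"
proof -
  have "(\<lambda>n. Re (X n)) \<longlonglongrightarrow> Re L" "(\<lambda>n. Im (X n)) \<longlonglongrightarrow> Im L"
    using assms(1) by (auto intro: tendsto_intros)
  moreover have "Re (X n) \<ge> 0" "Im (X n) = 0" for n
    using assms(2)[of n] by (auto simp: less_eq_complex_def)
  ultimately show ?thesis
    by (auto simp: less_eq_complex_def LIMSEQ_const_iff intro: LIMSEQ_le_const)
qed

text \<open>
  Polarization: on the span of two basis vectors the form at \<open>(1, z)\<close> is real; for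
  \<open>z = 1\<close> and \<open>z = \<i>\<close> this makes the imaginary and the real part of \<open>a\<^sub>i\<^sub>j - cnj(a\<^sub>j\<^sub>i)\<close> vanish.
\<close>

lemma hermitian_if_form_nonneg:
  fixes a :: "'i \<Rightarrow> 'i \<Rightarrow> complex"
  assumes "finite A"
    and form: "\<And>c. 0 \<le> (\<Sum>p\<in>A. \<Sum>q\<in>A. a p q * c q * cnj (c p))"
    and "i \<in> A" "j \<in> A"
  shows "a i j = cnj (a j i)"
proof -
  have diag: "0 \<le> a p p" if "p \<in> A" for p
  proof -
    have "(\<Sum>s\<in>A. \<Sum>q\<in>A. a s q * of_bool (q = p) * cnj (of_bool (s = p)))
        = (\<Sum>s\<in>{p}. \<Sum>q\<in>{p}. a s q)"
      using assms(1) that by (intro sum.mono_neutral_cong_right) auto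
    with form[of "\<lambda>q. of_bool (q = p)"] show ?thesis by simp
  qed
  show ?thesis
  proof (cases "i = j")
    case True
    with diag[OF \<open>i \<in> A\<close>] show ?thesis
      by (auto simp: less_eq_complex_def complex_eq_iff)
  next
    case False
    have two: "0 \<le> a i i + a i j * z + a j i * cnj z + a j j * z * cnj z" for z
    proof -
      define c where "c = (\<lambda>q. if q = i then 1 else if q = j then z else 0)"
      have "(\<Sum>q\<in>A. a p q * c q * cnj (c p)) = (\<Sum>q\<in>{i, j}. a p q * c q * cnj (c p))" for p
        using assms by (intro sum.mono_neutral_right) (auto simp: c_def)
      then have "(\<Sum>p\<in>A. \<Sum>q\<in>A. a p q * c q * cnj (c p))
          = (\<Sum>p\<in>A. \<Sum>q\<in>{i, j}. a p q * c q * cnj (c p))" by simp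
      also have "\<dots> = (\<Sum>p\<in>{i, j}. \<Sum>q\<in>{i, j}. a p q * c q * cnj (c p))"
        using assms by (intro sum.mono_neutral_right) (auto simp: c_def)
      also have "\<dots> = a i i + a i j * z + a j i * cnj z + a j j * z * cnj z"
        using False by (simp add: c_def)
      finally show ?thesis using form[of c] by simp
    qed
    show ?thesis
      using two[of 1] two[of \<i>] diag[OF \<open>i \<in> A\<close>] diag[OF \<open>j \<in> A\<close>]
      by (auto simp: less_eq_complex_def complex_eq_iff)
  qed
qed

lemma positive_operator_cong:
  assumes "\<And>x. x \<in> carrier_vec n \<Longrightarrow> P x = Q x"
  shows "positive_operator n P \<longleftrightarrow> positive_operator n Q"
  by (simp add: positive_operator_def Pi_iff assms cong: ball_cong conj_cong)

text \<open>
  Linearity and boundedness hold for every matrix, and self-adjointness follows from the sign of the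
  form, so the form alone decides.
\<close>

lemma positive_operator_iff_form_nonneg:
  fixes a :: "nat \<Rightarrow> nat \<Rightarrow> complex" and n :: nat
  defines "P \<equiv> \<lambda>x. Matrix.vec n (\<lambda>i. \<Sum>j<n. a i j * x $ j)"
  shows "positive_operator n P \<longleftrightarrow> (\<forall>c. 0 \<le> (\<Sum>i<n. \<Sum>j<n. a i j * c j * cnj (c i)))"
proof
  have inner: "P x \<bullet>c y = (\<Sum>i<n. \<Sum>j<n. a i j * x $ j * cnj (y $ i))" if "y \<in> carrier_vec n" for x y
    using that by (simp add: P_def scalar_prod_def sum_distrib_right lessThan_atLeast0)
  {
    assume "positive_operator n P"
    then have "\<forall>x\<in>carrier_vec n. 0 \<le> P x \<bullet>c x"
      unfolding positive_operator_def by blast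
    then have "0 \<le> P (Matrix.vec n c) \<bullet>c Matrix.vec n c" for c
      by (rule bspec) (rule vec_carrier)
    then show "\<forall>c. 0 \<le> (\<Sum>i<n. \<Sum>j<n. a i j * c j * cnj (c i))"
      by (simp add: inner)
  next
    assume form: "\<forall>c. 0 \<le> (\<Sum>i<n. \<Sum>j<n. a i j * c j * cnj (c i))"
    have herm: "a i j = cnj (a j i)" if "i < n" "j < n" for i j
      using hermitian_if_form_nonneg[of "{..<n}" a i j] form that by auto
    have sa: "P x \<bullet>c y = x \<bullet>c P y" if "x \<in> carrier_vec n" "y \<in> carrier_vec n" for x y
    proof -
      have "x \<bullet>c P y = (\<Sum>j<n. \<Sum>i<n. x $ j * (cnj (a j i) * cnj (y $ i)))"
        using that by (simp add: P_def scalar_prod_def sum_distrib_left lessThan_atLeast0)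
      also have "\<dots> = (\<Sum>i<n. \<Sum>j<n. x $ j * (cnj (a j i) * cnj (y $ i)))"
        by (rule sum.swap)
      also have "\<dots> = P x \<bullet>c y"
        unfolding inner[OF that(2)] by (intro sum.cong refl) (simp add: herm[symmetric])
      finally show ?thesis by simp
    qed
    \<comment> \<open>Estimating every entry of \<open>x\<close> by its Euclidean norm bounds \<open>P\<close> by the sum of the squared row sums of \<open>\<bar>a\<bar>\<close>.\<close>
    define B where "B = (\<Sum>i<n. (\<Sum>j<n. cmod (a i j))\<^sup>2)"
    have sq: "Re (x \<bullet>c x) = (\<Sum>i<n. (cmod (x $ i))\<^sup>2)" if "x \<in> carrier_vec n" for x :: "complex Matrix.vec"
      using that by (simp add: scalar_prod_def lessThan_atLeast0 cmod_power2 flip: power2_eq_square)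
    have bd: "Re (P x \<bullet>c P x) \<le> B * Re (x \<bullet>c x)" if x: "x \<in> carrier_vec n" for x
    proof -
      define N where "N = (\<Sum>i<n. (cmod (x $ i))\<^sup>2)"
      have N: "cmod (x $ j) \<le> sqrt N" if "j < n" for j
        unfolding N_def using that by (intro real_le_rsqrt member_le_sum) auto
      have N0: "0 \<le> N" unfolding N_def by (intro sum_nonneg) auto
      have "(cmod (\<Sum>j<n. a i j * x $ j))\<^sup>2 \<le> (\<Sum>j<n. cmod (a i j))\<^sup>2 * N" for i
      proof -
        have "cmod (\<Sum>j<n. a i j * x $ j) \<le> (\<Sum>j<n. cmod (a i j) * sqrt N)"
          by (intro sum_norm_le) (auto simp: norm_mult intro!: mult_left_mono N)
        then have "(cmod (\<Sum>j<n. a i j * x $ j))\<^sup>2 \<le> ((\<Sum>j<n. cmod (a i j)) * sqrt N)\<^sup>2"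
          by (intro power_mono) (auto simp: sum_distrib_right)
        then show ?thesis using N0 by (simp add: power_mult_distrib)
      qed
      then have "(\<Sum>i<n. (cmod (\<Sum>j<n. a i j * x $ j))\<^sup>2) \<le> B * N"
        unfolding B_def sum_distrib_right by (intro sum_mono)
      moreover have "Re (P x \<bullet>c P x) = (\<Sum>i<n. (cmod (\<Sum>j<n. a i j * x $ j))\<^sup>2)"
        by (subst sq) (auto simp: P_def)
      ultimately show ?thesis using sq[OF x] by (simp add: N_def)
    qed
    show "positive_operator n P"
      unfolding positive_operator_def
    proof (intro conjI ballI allI)
      show "P \<in> carrier_vec n \<rightarrow> carrier_vec n"
        by (auto simp: P_def)
      show "P (x + y) = P x + P y" if "x \<in> carrier_vec n" "y \<in> carrier_vec n" for x y
        using that by (auto simp: P_def distrib_left sum.distrib intro!: eq_vecI)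
      show "P (c \<cdot>\<^sub>v x) = c \<cdot>\<^sub>v P x" if "x \<in> carrier_vec n" for c x
        using that by (auto simp: P_def sum_distrib_left mult_ac intro!: eq_vecI sum.cong)
      show "\<exists>B. \<forall>x\<in>carrier_vec n. Re (P x \<bullet>c P x) \<le> B * Re (x \<bullet>c x)"
        using bd by blast
      show "P x \<bullet>c y = x \<bullet>c P y" if "x \<in> carrier_vec n" "y \<in> carrier_vec n" for x y
        by (rule sa[OF that])
      show "0 \<le> P x \<bullet>c x" if "x \<in> carrier_vec n" for x
        using form that by (simp add: inner)
    qed
  }
qed

text \<open>
  Sums over finite sets are easier to rearrange than enumerations. Because the points of an
  enumeration are distinct, a coefficient vector indexed by positions is the same as one indexed by
  points.
\<close>

lemma positive_definite_on_iff_form_nonneg: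
  assumes "hermitian_kernel_on S K"
  shows "positive_definite_on S K \<longleftrightarrow>
    (\<forall>A c. finite A \<and> A \<subseteq> S \<longrightarrow> 0 \<le> (\<Sum>a\<in>A. \<Sum>b\<in>A. K a b * c b * cnj (c a)))"
proof -
  have op: "positive_operator (length xs) (\<lambda>c. kernel_matrix K xs *\<^sub>v c) \<longleftrightarrow>
      (\<forall>c. 0 \<le> (\<Sum>i<length xs. \<Sum>j<length xs. K (xs ! i) (xs ! j) * c j * cnj (c i)))" for xs
  proof -
    have "kernel_matrix K xs *\<^sub>v x
        = Matrix.vec (length xs) (\<lambda>i. \<Sum>j<length xs. K (xs ! i) (xs ! j) * x $ j)"
      if "x \<in> carrier_vec (length xs)" for x
      using that by (auto simp: kernel_matrix_def scalar_prod_def lessThan_atLeast0 intro!: eq_vecI)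
    then show ?thesis
      by (subst positive_operator_iff_form_nonneg[symmetric]) (rule positive_operator_cong)
  qed
  have enum: "(\<Sum>i<length xs. h (xs ! i)) = (\<Sum>a\<in>set xs. h a)"
    if "distinct xs" for xs :: "'a list" and h :: "'a \<Rightarrow> complex"
    using sum.reindex_bij_betw[OF bij_betw_nth[OF that refl refl], of h] .
  show ?thesis
  proof (intro iffI allI impI; (elim conjE)?)
    fix A :: "'a set" and c
    assume "positive_definite_on S K" and "finite A" "A \<subseteq> S"
    moreover obtain xs where xs: "set xs = A" "distinct xs"
      using finite_distinct_list[OF \<open>finite A\<close>] by blast
    ultimately have "0 \<le> (\<Sum>i<length xs. \<Sum>j<length xs. K (xs ! i) (xs ! j) * c (xs ! j) * cnj (c (xs ! i)))"
      unfolding positive_definite_on_def op by auto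
    then show "0 \<le> (\<Sum>a\<in>A. \<Sum>b\<in>A. K a b * c b * cnj (c a))"
      using enum[OF xs(2)] by (simp add: enum[OF xs(2), of "\<lambda>b. K _ b * c b * cnj (c _)"] enum[OF xs(2), of "\<lambda>a. \<Sum>b\<in>A. K a b * c b * cnj (c a)"] xs(1))
  next
    assume form: "\<forall>A c. finite A \<and> A \<subseteq> S \<longrightarrow> 0 \<le> (\<Sum>a\<in>A. \<Sum>b\<in>A. K a b * c b * cnj (c a))"
    have "0 \<le> (\<Sum>i<length xs. \<Sum>j<length xs. K (xs ! i) (xs ! j) * c j * cnj (c i))"
      if xs: "distinct xs" "set xs \<subseteq> S" for xs c
    proof -
      define c' where "c' = (\<lambda>a. c (THE i. i < length xs \<and> xs ! i = a))"
      have c': "c' (xs ! i) = c i" if "i < length xs" for i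
        unfolding c'_def using that xs(1)
        by (intro arg_cong[of _ _ c] the_equality) (auto simp: nth_eq_iff_index_eq)
      have "0 \<le> (\<Sum>a\<in>set xs. \<Sum>b\<in>set xs. K a b * c' b * cnj (c' a))"
        using form xs(2) by auto
      also have "\<dots> = (\<Sum>i<length xs. \<Sum>j<length xs. K (xs ! i) (xs ! j) * c' (xs ! j) * cnj (c' (xs ! i)))"
        by (simp only: flip: enum[OF xs(1)])
      also have "\<dots> = (\<Sum>i<length xs. \<Sum>j<length xs. K (xs ! i) (xs ! j) * c j * cnj (c i))"
        by (simp add: c')
      finally show ?thesis .
    qed
    with assms show "positive_definite_on S K"
      unfolding positive_definite_on_def op by auto
  qed
qed

text \<open>
  The operator contracts the first index of \<open>d\<^sub>j\<close>, so its matrix is the transpose of \<open>(d\<^sub>j(k,k'))\<close>;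
  this is why \<open>x\<^sub>k\<close> belongs to the first index here and the conjugate to the second.
\<close>

lemma positive_block_operator_iff_form_nonneg:
  "positive_operator (2 * j + 1) (block_operator d j) \<longleftrightarrow>
    (\<forall>x. 0 \<le> (\<Sum>k = - int j..int j. \<Sum>k' = - int j..int j. d j k k' * x k * cnj (x k')))"
proof -
  have reindex: "(\<Sum>k = - int j..int j. h k) = (\<Sum>i<2 * j + 1. h (int i - int j))" for h :: "int \<Rightarrow> complex"
    by (rule sum.reindex_bij_witness[of _ "\<lambda>i. int i - int j" "\<lambda>k. nat (k + int j)"]) auto
  have "positive_operator (2 * j + 1) (block_operator d j) \<longleftrightarrow>
    (\<forall>c. 0 \<le> (\<Sum>i'<2 * j + 1. \<Sum>i<2 * j + 1. d j (int i - int j) (int i' - int j) * c i * cnj (c i')))"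
    unfolding block_operator_def[abs_def] by (rule positive_operator_iff_form_nonneg)
  also have "\<dots> \<longleftrightarrow> (\<forall>c. 0 \<le> (\<Sum>i<2 * j + 1. \<Sum>i'<2 * j + 1.
      d j (int i - int j) (int i' - int j) * c i * cnj (c i')))"
    by (subst sum.swap) (rule refl)
  also have "\<dots> \<longleftrightarrow> (\<forall>x :: int \<Rightarrow> complex. 0 \<le> (\<Sum>i<2 * j + 1. \<Sum>i'<2 * j + 1.
      d j (int i - int j) (int i' - int j) * x (int i - int j) * cnj (x (int i' - int j))))"
    (is "_ \<longleftrightarrow> (\<forall>x. ?Q x)")
  proof (intro iffI allI)
    fix c :: "nat \<Rightarrow> complex"
    assume "\<forall>x. ?Q x"
    then have "?Q (\<lambda>k. c (nat (k + int j)))" by (rule spec)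
    then show "0 \<le> (\<Sum>i<2 * j + 1. \<Sum>i'<2 * j + 1.
      d j (int i - int j) (int i' - int j) * c i * cnj (c i'))" by simp
  next
    fix x :: "int \<Rightarrow> complex"
    assume "\<forall>c. 0 \<le> (\<Sum>i<2 * j + 1. \<Sum>i'<2 * j + 1.
      d j (int i - int j) (int i' - int j) * c i * cnj (c i'))"
    then show "?Q x" by (rule spec)
  qed
  finally show ?thesis by (simp only: reindex)
qed

section \<open>Integrating a positive definite kernel\<close>

text \<open>
  Rounding to the first point of a finite net that is close enough. Choosing the first one makes the
  cells disjoint and the map measurable. It takes values in the net even off \<open>S\<close>, so a kernel
  composed with it has only finitely many values, all from points of \<open>S\<close>.
\<close>

lemma finite_valued_approximation:
  fixes S :: "'a::{metric_space, second_countable_topology} set"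
  assumes "compact S" "S \<noteq> {}" "e > 0"
  obtains r :: "'a \<Rightarrow> 'a" and C
  where "finite C" "C \<subseteq> S" "range r \<subseteq> C" "r \<in> borel \<rightarrow>\<^sub>M count_space UNIV"
    "\<And>x. x \<in> S \<Longrightarrow> dist (r x) x < e"
proof -
  from assms(1,3) obtain C where C: "finite C" "C \<subseteq> S" "S \<subseteq> (\<Union>c\<in>C. ball c e)"
    by (metis seq_compact_imp_totally_bounded compact_imp_seq_compact)
  with assms(2) have "C \<noteq> {}" by auto
  define r where "r = (\<lambda>x. from_nat_into C (LEAST i. dist (from_nat_into C i) x < e))"
  have "r \<in> borel \<rightarrow>\<^sub>M count_space UNIV"
    unfolding r_def by measurable
  moreover have "dist (r x) x < e" if x: "x \<in> S" for x
  proof -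
    obtain c where "c \<in> C" "dist c x < e" using C(3) x by auto
    then have "dist (from_nat_into C (to_nat_on C c)) x < e"
      using C(1) by (simp add: countable_finite)
    then show ?thesis unfolding r_def by (rule LeastI)
  qed
  moreover have "range r \<subseteq> C"
    unfolding r_def using from_nat_into[OF \<open>C \<noteq> {}\<close>] by auto
  ultimately show ?thesis using that C by blast
qed

lemma integrable_product_pair:
  fixes f g :: "'a \<Rightarrow> complex"
  assumes "sigma_finite_measure M" "integrable M f" "integrable M g"
  shows "integrable (M \<Otimes>\<^sub>M M) (\<lambda>(x, y). f x * g y)"
    and "(LINT (x, y) | (M \<Otimes>\<^sub>M M). f x * g y) = (LINT x | M. f x) * (LINT y | M. g y)"
proof -
  interpret sigma_finite_measure M by fact
  interpret P: pair_sigma_finite M M ..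
  show *: "integrable (M \<Otimes>\<^sub>M M) (\<lambda>(x, y). f x * g y)"
    using assms by (intro P.Fubini_integrable) (auto simp: norm_mult)
  show "(LINT (x, y) | (M \<Otimes>\<^sub>M M). f x * g y) = (LINT x | M. f x) * (LINT y | M. g y)"
    by (subst P.integral_fst[symmetric, OF *]) simp
qed

text \<open>The \<open>\<sigma>\<close>-algebra is that of \<open>S\<close> and not of the surrounding space, as for the surface measure.\<close>

locale compact_kernel = finite_measure M
  for M :: "'a::{metric_space, second_countable_topology} measure" +
  fixes S :: "'a set" and K :: "'a \<Rightarrow> 'a \<Rightarrow> complex"
  assumes sets_M: "sets M = sets (restrict_space borel S)"
    and compact_S: "compact S"
    and cont_K: "continuous_on (S \<times> S) (\<lambda>(x, y). K x y)"
begin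

lemma space_M: "space M = S"
  using sets_eq_imp_space_eq[OF sets_M] by (simp add: space_restrict_space)

lemma measurable_K: "(\<lambda>(x, y). K x y) \<in> borel_measurable (M \<Otimes>\<^sub>M M)"
proof -
  have "(\<lambda>x. x) \<in> M \<rightarrow>\<^sub>M borel"
    by (simp add: measurable_cong_sets[OF sets_M refl] measurable_restrict_space1)
  then have "(\<lambda>p. (fst p, snd p)) \<in> M \<Otimes>\<^sub>M M \<rightarrow>\<^sub>M restrict_space borel (S \<times> S)"
    by (intro measurable_restrict_space2 borel_measurable_Pair
          measurable_compose[OF measurable_fst] measurable_compose[OF measurable_snd])
       (auto simp: space_pair_measure space_M)
  from measurable_compose[OF this borel_measurable_continuous_on_restrict[OF cont_K]]
  show ?thesis by simp
qed

lemma bounded_K: obtains B where "\<And>x y. x \<in> S \<Longrightarrow> y \<in> S \<Longrightarrow> norm (K x y) \<le> B"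
proof -
  have "bounded ((\<lambda>(x, y). K x y) ` (S \<times> S))"
    by (intro compact_imp_bounded compact_continuous_image cont_K compact_Times compact_S)
  then obtain B where B: "\<forall>z\<in>(\<lambda>(x, y). K x y) ` (S \<times> S). norm z \<le> B"
    by (auto simp: bounded_iff)
  show ?thesis by (rule that[of B]) (use B in auto)
qed

lemma integrable_kernel:
  assumes "integrable M f" "integrable M g"
  shows "integrable (M \<Otimes>\<^sub>M M) (\<lambda>(x, y). K x y * (f x * g y))"
proof -
  obtain B where B: "\<And>x y. x \<in> S \<Longrightarrow> y \<in> S \<Longrightarrow> norm (K x y) \<le> B"
    using bounded_K by blast
  have int: "integrable (M \<Otimes>\<^sub>M M) (\<lambda>p. B * (f (fst p) * g (snd p)))"
    using integrable_product_pair(1)[OF sigma_finite_measure_axioms assms]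
    by (intro integrable_mult_right) (simp add: case_prod_unfold)
  have [measurable]: "f \<in> borel_measurable M" "g \<in> borel_measurable M"
    using assms by auto
  note measurable_K[unfolded case_prod_unfold, measurable]
  show ?thesis unfolding case_prod_unfold
  proof (rule Bochner_Integration.integrable_bound[OF int])
    show "AE p in (M \<Otimes>\<^sub>M M). norm (K (fst p) (snd p) * (f (fst p) * g (snd p)))
        \<le> norm (B * (f (fst p) * g (snd p)))"
    proof (intro AE_I2)
      fix p assume "p \<in> space (M \<Otimes>\<^sub>M M)"
      then have "norm (K (fst p) (snd p)) \<le> B"
        using B by (auto simp: space_pair_measure space_M)
      then show "norm (K (fst p) (snd p) * (f (fst p) * g (snd p)))
        \<le> norm (B * (f (fst p) * g (snd p)))"
        unfolding norm_mult by (intro mult_right_mono) auto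
    qed
  qed measurable
qed

text \<open>
  After rounding with \<open>r\<^sub>n\<close> the kernel is constant, equal to \<open>K a b\<close>, on the product cell
  \<open>{r\<^sub>n = a} \<times> {r\<^sub>n = b}\<close>, so the integral is the form of \<open>K\<close> on the net with coefficients
  \<open>c\<^sub>a = \<integral> f\<close> over the cell of \<open>a\<close>. Continuity of \<open>K\<close> gives pointwise convergence as the net is refined, and its
  boundedness gives the integrable majorant.
\<close>

lemma form_integral_nonneg:
  assumes form: "\<And>A c. finite A \<Longrightarrow> A \<subseteq> S \<Longrightarrow> 0 \<le> (\<Sum>a\<in>A. \<Sum>b\<in>A. K a b * c b * cnj (c a))"
    and f: "integrable M f"
  shows "0 \<le> (LINT (x, y) | (M \<Otimes>\<^sub>M M). K x y * (cnj (f x) * f y))"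
proof (cases "S = {}")
  case True
  then have "space (M \<Otimes>\<^sub>M M) = {}" by (simp add: space_pair_measure space_M)
  then show ?thesis by (simp add: Bochner_Integration.integral_empty)
next
  case False
  let ?P = "\<lambda>n (r :: 'a \<Rightarrow> 'a) C. finite C \<and> C \<subseteq> S \<and> range r \<subseteq> C \<and>
    r \<in> borel \<rightarrow>\<^sub>M count_space UNIV \<and> (\<forall>x\<in>S. dist (r x) x < inverse (real (Suc n)))"
  have "\<forall>n. \<exists>r C. ?P n r C"
  proof
    fix n
    show "\<exists>r C. ?P n r C"
      using finite_valued_approximation[OF compact_S False, of "inverse (real (Suc n))"]
      by (metis inverse_positive_iff_positive of_nat_0_less_iff zero_less_Suc)
  qed
  from choice[OF this] obtain r where "\<forall>n. \<exists>C. ?P n (r n) C" ..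
  from choice[OF this] obtain C where "\<forall>n. ?P n (r n) (C n)" ..
  then have fin: "\<And>n. finite (C n)" and CS: "\<And>n. C n \<subseteq> S"
    and range: "\<And>n. range (r n) \<subseteq> C n"
    and meas: "\<And>n. r n \<in> borel \<rightarrow>\<^sub>M count_space UNIV"
    and close: "\<And>n x. x \<in> S \<Longrightarrow> dist (r n x) x < inverse (real (Suc n))"
    by blast+
  have rS: "r n x \<in> S" for n x using range[of n] CS[of n] by blast
  have id: "(\<lambda>x. x) \<in> M \<rightarrow>\<^sub>M borel"
    by (simp add: measurable_cong_sets[OF sets_M refl] measurable_restrict_space1)
  have [measurable]: "r n \<in> M \<rightarrow>\<^sub>M count_space UNIV" for n
    using measurable_compose[OF id meas[of n]] .
  have [measurable]: "f \<in> borel_measurable M" using f by auto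
  have step: "0 \<le> (LINT p | (M \<Otimes>\<^sub>M M). K (r n (fst p)) (r n (snd p)) * (cnj (f (fst p)) * f (snd p)))"
    and step_meas: "(\<lambda>p. K (r n (fst p)) (r n (snd p)) * (cnj (f (fst p)) * f (snd p)))
        \<in> borel_measurable (M \<Otimes>\<^sub>M M)" for n
  proof -
    define F where "F = (\<lambda>p. K (r n (fst p)) (r n (snd p)) * (cnj (f (fst p)) * f (snd p)))"
    \<comment> \<open>The part of \<open>f\<close> on the cell of \<open>a\<close>; \<open>F\<close> splits into the products \<open>T a b\<close> of such parts.\<close>
    define h where "h = (\<lambda>a x. of_bool (r n x = a) * f x)"
    have h: "integrable M (h a)" for a
      unfolding h_def by (rule Bochner_Integration.integrable_bound[OF f]) (auto simp: norm_mult)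
    define T where "T = (\<lambda>a b p. K a b * (cnj (h a (fst p)) * h b (snd p)))"
    have prod: "integrable (M \<Otimes>\<^sub>M M) (\<lambda>(x, y). cnj (h a x) * h b y)"
      "(LINT (x, y) | (M \<Otimes>\<^sub>M M). cnj (h a x) * h b y) = cnj (LINT x | M. h a x) * (LINT x | M. h b x)"
      for a b
      using integrable_product_pair[OF sigma_finite_measure_axioms, of "\<lambda>x. cnj (h a x)" "h b"] h by auto
    have T: "integrable (M \<Otimes>\<^sub>M M) (T a b)"
      "integral\<^sup>L (M \<Otimes>\<^sub>M M) (T a b) = K a b * (LINT x | M. h b x) * cnj (LINT x | M. h a x)" for a b
      using prod[of a b] by (auto simp: T_def case_prod_unfold mult_ac)
    have F_eq: "F = (\<lambda>p. \<Sum>a\<in>C n. \<Sum>b\<in>C n. T a b p)"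
    proof
      fix p
      have C: "r n (fst p) \<in> C n" "r n (snd p) \<in> C n" using range by blast+
      have "(\<Sum>b\<in>C n. T a b p) = (\<Sum>b\<in>{r n (snd p)}. T a b p)" for a
        using fin C by (intro sum.mono_neutral_right) (auto simp: T_def h_def)
      then have "(\<Sum>a\<in>C n. \<Sum>b\<in>C n. T a b p) = (\<Sum>a\<in>C n. T a (r n (snd p)) p)"
        by simp
      also have "\<dots> = (\<Sum>a\<in>{r n (fst p)}. T a (r n (snd p)) p)"
        using fin C by (intro sum.mono_neutral_right) (auto simp: T_def h_def)
      finally show "F p = (\<Sum>a\<in>C n. \<Sum>b\<in>C n. T a b p)"
        by (simp add: F_def T_def h_def)
    qed
    have "integral\<^sup>L (M \<Otimes>\<^sub>M M) F
        = (\<Sum>a\<in>C n. \<Sum>b\<in>C n. K a b * (LINT x | M. h b x) * cnj (LINT x | M. h a x))"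
      unfolding F_eq by (simp add: T)
    also have "0 \<le> \<dots>" by (rule form[OF fin CS])
    finally show "0 \<le> (LINT p | (M \<Otimes>\<^sub>M M). K (r n (fst p)) (r n (snd p)) * (cnj (f (fst p)) * f (snd p)))"
      unfolding F_def .
    have "integrable (M \<Otimes>\<^sub>M M) F" unfolding F_eq by (intro Bochner_Integration.integrable_sum T)
    then show "(\<lambda>p. K (r n (fst p)) (r n (snd p)) * (cnj (f (fst p)) * f (snd p)))
        \<in> borel_measurable (M \<Otimes>\<^sub>M M)" unfolding F_def by auto
  qed
  obtain B where B: "\<And>x y. x \<in> S \<Longrightarrow> y \<in> S \<Longrightarrow> norm (K x y) \<le> B"
    using bounded_K by blast
  have lim_r: "(\<lambda>n. r n x) \<longlonglongrightarrow> x" if "x \<in> S" for x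
  proof (rule metric_tendsto_imp_tendsto[OF LIMSEQ_inverse_real_of_nat])
    show "\<forall>\<^sub>F n in sequentially. dist (r n x) x \<le> dist (inverse (real (Suc n))) 0"
      using close[OF that] by (intro always_eventually) (auto simp: less_imp_le)
  qed
  have int: "integrable (M \<Otimes>\<^sub>M M) (\<lambda>(x, y). cnj (f x) * f y)"
    using integrable_product_pair(1)[OF sigma_finite_measure_axioms, of "\<lambda>x. cnj (f x)" f] f by simp
  have "(\<lambda>n. LINT p | (M \<Otimes>\<^sub>M M). K (r n (fst p)) (r n (snd p)) * (cnj (f (fst p)) * f (snd p)))
      \<longlonglongrightarrow> (LINT p | (M \<Otimes>\<^sub>M M). K (fst p) (snd p) * (cnj (f (fst p)) * f (snd p)))"
  proof (rule integral_dominated_convergence[where w = "\<lambda>p. B * norm (cnj (f (fst p)) * f (snd p))"])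
    show "integrable (M \<Otimes>\<^sub>M M) (\<lambda>p. B * norm (cnj (f (fst p)) * f (snd p)))"
      using integrable_norm[OF int] by (intro integrable_mult_right) (simp add: case_prod_unfold)
    show "(\<lambda>p. K (fst p) (snd p) * (cnj (f (fst p)) * f (snd p))) \<in> borel_measurable (M \<Otimes>\<^sub>M M)"
      using measurable_K borel_measurable_integrable[OF int]
      unfolding case_prod_unfold by (rule borel_measurable_times)
    show "AE p in (M \<Otimes>\<^sub>M M). norm (K (r n (fst p)) (r n (snd p)) * (cnj (f (fst p)) * f (snd p)))
        \<le> B * norm (cnj (f (fst p)) * f (snd p))" for n
      unfolding norm_mult[of "K _ _"] by (intro AE_I2 mult_right_mono B rS) auto
    show "AE p in (M \<Otimes>\<^sub>M M). (\<lambda>n. K (r n (fst p)) (r n (snd p)) * (cnj (f (fst p)) * f (snd p)))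
        \<longlonglongrightarrow> K (fst p) (snd p) * (cnj (f (fst p)) * f (snd p))"
    proof (intro AE_I2 tendsto_mult tendsto_const)
      fix p assume "p \<in> space (M \<Otimes>\<^sub>M M)"
      then have p: "fst p \<in> S" "snd p \<in> S" by (auto simp: space_pair_measure space_M)
      have "(\<lambda>n. (r n (fst p), r n (snd p))) \<longlonglongrightarrow> (fst p, snd p)"
        by (intro tendsto_Pair lim_r p)
      from continuous_on_tendsto_compose[OF cont_K this] p rS
      show "(\<lambda>n. K (r n (fst p)) (r n (snd p))) \<longlonglongrightarrow> K (fst p) (snd p)"
        by (simp add: case_prod_unfold mem_Times_iff)
    qed
  qed (rule step_meas)
  then have "0 \<le> (LINT p | (M \<Otimes>\<^sub>M M). K (fst p) (snd p) * (cnj (f (fst p)) * f (snd p)))"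
    by (rule tendsto_nonneg_complex) (rule step)
  then show ?thesis by (simp add: case_prod_unfold)
qed

end

section \<open>The sphere and its harmonics\<close>

lemma spherical_point_in_S2: "spherical_point p \<in> S2"
proof (cases p)
  case (Pair t u)
  have "(sin t * cos u)\<^sup>2 + (sin t * sin u)\<^sup>2 + (cos t)\<^sup>2 = (sin t)\<^sup>2 * ((cos u)\<^sup>2 + (sin u)\<^sup>2) + (cos t)\<^sup>2"
    by (simp only: power_mult_distrib distrib_left)
  also have "\<dots> = 1" by simp
  finally show ?thesis
    unfolding Pair by (simp add: spherical_point_def norm_vec_def L2_set_def sum_3)
qed

lemma measurable_spherical_point: "spherical_point \<in> borel \<rightarrow>\<^sub>M restrict_space borel S2"
proof (rule measurable_restrict_space2)
  have "continuous_on UNIV spherical_point"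
    unfolding continuous_on_componentwise[where f = spherical_point]
  proof
    fix b :: "real^3" assume "b \<in> Basis"
    then obtain i where b: "b = axis i 1" by (auto simp: Basis_vec_def)
    show "continuous_on UNIV (\<lambda>p. inner (spherical_point p) b)"
      using exhaust_3[of i]
      by (elim disjE; simp add: b inner_axis spherical_point_def case_prod_unfold; intro continuous_intros)
  qed
  then show "spherical_point \<in> borel_measurable borel" by (rule borel_measurable_continuous_onI)
qed (use spherical_point_in_S2 in auto)

lemma sets_surface_measure: "sets surface_measure = sets (restrict_space borel S2)"
  by (simp add: surface_measure_def)

lemma finite_surface_measure: "finite_measure surface_measure"
  unfolding surface_measure_def
proof (rule finite_measure.finite_measure_distr)
  let ?w = "\<lambda>(t, u). ennreal (sin t) * indicator ({0..pi} \<times> {0..2 * pi}) (t, u) :: ennreal"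
  have [measurable]: "{0..pi} \<times> {0..2 * pi} \<in> sets borel"
    by (simp add: borel_closed closed_Times)
  have [measurable]: "(fst :: real \<times> real \<Rightarrow> real) \<in> borel_measurable borel"
    by (intro borel_measurable_continuous_onI continuous_intros)
  have w [measurable]: "?w \<in> borel_measurable lborel"
    unfolding case_prod_unfold by simp
  have "(\<integral>\<^sup>+ p. ?w p \<partial>lborel) \<le> (\<integral>\<^sup>+ p. indicator ({0..pi} \<times> {0..2 * pi}) p \<partial>lborel)"
    by (intro nn_integral_mono) (auto simp: indicator_def ennreal_le_1)
  also have "\<dots> = emeasure lborel (cbox (0, 0) (pi, 2 * pi))"
    by (subst nn_integral_indicator) (auto simp: cbox_Pair_eq)
  also have "\<dots> < \<infinity>" by (rule emeasure_lborel_cbox_finite)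
  finally have "(\<integral>\<^sup>+ p. ?w p \<partial>lborel) < \<infinity>" .
  then show "finite_measure (density lborel ?w)"
    by (intro finite_measureI) (simp add: emeasure_density w)
  show "spherical_point \<in> density lborel ?w \<rightarrow>\<^sub>M restrict_space borel S2"
    using measurable_spherical_point by simp
qed

text \<open>
  The longitude jumps along a meridian, but the phase of a harmonic depends only on the direction of
  \<open>z\<close>. This form makes its measurability evident.
\<close>

lemma exp_longitude:
  "exp (\<i> * of_int k * complex_of_real (Arg z)) = (if z = 0 then 1 else sgn z powi k)"
proof -
  have "exp (\<i> * of_int k * complex_of_real (Arg z)) = exp (\<i> * complex_of_real (Arg z)) powi k"
    by (simp add: exp_power_int mult_ac)
  also have "\<dots> = (if z = 0 then 1 else sgn z powi k)"
    by (simp add: cis_conv_exp[symmetric] cis_Arg Arg_zero)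
  finally show ?thesis .
qed

lemma integrable_spherical_harmonic: "integrable surface_measure (spherical_harmonic j k)"
proof -
  interpret finite_measure surface_measure by (rule finite_surface_measure)
  define c where "c = 1 / sqrt (2 * pi) *
      sqrt ((2 * real j + 1) / 2 * (fact (nat (int j - k)) / fact (nat (int j + k))))"
  define z where "z = (\<lambda>\<xi> :: real^3. Complex (vec_nth \<xi> 1) (vec_nth \<xi> 2))"
  define Y where "Y = (\<lambda>\<xi> :: real^3. complex_of_real (c * assoc_legendre j k (vec_nth \<xi> 3)) *
      (if z \<xi> = 0 then 1 else sgn (z \<xi>) powi k))"
  have range3: "\<bar>vec_nth \<xi> 3\<bar> \<le> 1" if "\<xi> \<in> S2" for \<xi>
    using component_le_norm_cart[of \<xi> 3] that by simp
  have Y_eq: "spherical_harmonic j k \<xi> = Y \<xi>" if "\<xi> \<in> S2" for \<xi>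
  proof -
    have "cos (colatitude \<xi>) = vec_nth \<xi> 3"
      unfolding colatitude_def using range3[OF that] by (intro cos_arccos) auto
    then show ?thesis
      by (simp add: spherical_harmonic_def Y_def c_def longitude_def exp_longitude z_def)
  qed
  have cont: "continuous_on A (assoc_legendre j k)" for A
    unfolding assoc_legendre_def Let_def by (cases "0 \<le> k") (auto intro!: continuous_intros)
  have [measurable]: "assoc_legendre j k \<in> borel_measurable borel"
    using cont by (rule borel_measurable_continuous_onI)
  have [measurable]: "(\<lambda>\<xi> :: real^3. vec_nth \<xi> i) \<in> borel_measurable borel" for i
    by (intro borel_measurable_continuous_onI continuous_intros)
  have [measurable]: "z \<in> borel_measurable borel"
    unfolding z_def Complex_eq by measurable
  have [measurable]: "(\<lambda>z :: complex. z powi k) \<in> borel_measurable borel"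
    by (cases "0 \<le> k") (simp_all add: power_int_def)
  have "Y \<in> borel_measurable borel"
    unfolding Y_def by measurable
  then have "Y \<in> borel_measurable surface_measure"
    by (simp add: measurable_cong_sets[OF sets_surface_measure refl] measurable_restrict_space1)
  moreover have "space surface_measure = S2"
    using sets_eq_imp_space_eq[OF sets_surface_measure] by (simp add: space_restrict_space)
  moreover note Y_eq
  ultimately have meas: "spherical_harmonic j k \<in> borel_measurable surface_measure"
    by (subst measurable_cong[of _ _ Y]) auto
  have "bounded (assoc_legendre j k ` {-1..1})"
    using cont by (intro compact_imp_bounded compact_continuous_image) auto
  then obtain B where "\<forall>y\<in>assoc_legendre j k ` {-1..1}. norm y \<le> B"
    unfolding bounded_iff by blast
  then have B: "\<bar>assoc_legendre j k x\<bar> \<le> B" if "\<bar>x\<bar> \<le> 1" for x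
    using that by (simp add: abs_le_iff)
  have "norm (spherical_harmonic j k \<xi>) \<le> \<bar>c\<bar> * B" if "\<xi> \<in> S2" for \<xi>
  proof -
    have "norm (spherical_harmonic j k \<xi>) = \<bar>c\<bar> * \<bar>assoc_legendre j k (vec_nth \<xi> 3)\<bar>"
      unfolding Y_eq[OF that] Y_def by (simp add: norm_mult norm_power_int norm_sgn abs_mult)
    also have "\<dots> \<le> \<bar>c\<bar> * B" using B range3[OF that] by (intro mult_left_mono) auto
    finally show ?thesis .
  qed
  then show ?thesis
    using \<open>space surface_measure = S2\<close> meas by (intro integrable_const_bound AE_I2) auto
qed

section \<open>The characterization\<close>

text \<open>
  The coefficient \<open>d\<^sub>j(k,k')\<close> integrates \<open>K\<close> against \<open>cnj(Y\<^sup>k(\<xi>)) Y\<^sup>k\<^sup>'(\<zeta>)\<close>. In the form it is paired with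
  \<open>x\<^sub>k cnj(x\<^sub>k\<^sub>')\<close>, so the function to integrate against must carry the conjugates \<open>cnj(x\<^sub>k)\<close>.
\<close>

lemma block_form_eq_integral:
  fixes j :: nat
  assumes K: "continuous_on (S2 \<times> S2) (\<lambda>(\<xi>, \<zeta>). K \<xi> \<zeta>)"
  defines "J \<equiv> {- int j..int j}"
  shows "(\<Sum>k\<in>J. \<Sum>k'\<in>J. kernel_coeff K j j k k' * x k * cnj (x k')) =
    (LINT (\<xi>, \<zeta>) | (surface_measure \<Otimes>\<^sub>M surface_measure). K \<xi> \<zeta> *
      (cnj (\<Sum>k\<in>J. cnj (x k) * spherical_harmonic j k \<xi>) * (\<Sum>k\<in>J. cnj (x k) * spherical_harmonic j k \<zeta>)))"
proof -
  interpret finite_measure surface_measure by (rule finite_surface_measure)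
  interpret compact_kernel surface_measure S2 K
    by unfold_locales (auto simp: sets_surface_measure K)
  let ?M = "surface_measure \<Otimes>\<^sub>M surface_measure"
  let ?Y = "spherical_harmonic j"
  let ?G = "\<lambda>k k' p. K (fst p) (snd p) * (cnj (?Y k (fst p)) * ?Y k' (snd p))"
  have G: "integrable ?M (?G k k')" for k k'
    using integrable_kernel[of "\<lambda>\<xi>. cnj (?Y k \<xi>)" "?Y k'"]
    by (simp add: case_prod_unfold integrable_spherical_harmonic)
  have "(LINT p | ?M. K (fst p) (snd p) *
      (cnj (\<Sum>k\<in>J. cnj (x k) * ?Y k (fst p)) * (\<Sum>k\<in>J. cnj (x k) * ?Y k (snd p))))
    = (LINT p | ?M. (\<Sum>k\<in>J. \<Sum>k'\<in>J. (x k * cnj (x k')) * ?G k k' p))"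
    by (simp only: cnj_sum sum_product) (simp add: sum_distrib_left mult_ac)
  also have "\<dots> = (\<Sum>k\<in>J. \<Sum>k'\<in>J. (x k * cnj (x k')) * integral\<^sup>L ?M (?G k k'))"
    by (subst Bochner_Integration.integral_sum Bochner_Integration.integral_mult_right;
        (intro Bochner_Integration.integrable_sum integrable_mult_right G)?)+ simp
  finally show ?thesis
    by (simp add: kernel_coeff_def case_prod_unfold mult_ac)
qed

text \<open>
  Each degree of the series is a finite sum of products of a function of \<open>\<xi>\<close> and a function of \<open>\<zeta>\<close>,
  so summing over the points first turns it into a form in the vector of sums \<open>x\<close>.
\<close>

lemma form_sums_block_forms:
  fixes c :: "real^3 \<Rightarrow> complex"
  assumes sums: "\<And>\<xi> \<zeta>. \<xi> \<in> S2 \<Longrightarrow> \<zeta> \<in> S2 \<Longrightarrow>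
           (\<lambda>j. \<Sum>k = - int j..int j. \<Sum>k' = - int j..int j.
              d j k k' * spherical_harmonic j k \<xi> * cnj (spherical_harmonic j k' \<zeta>))
           sums K \<xi> \<zeta>"
    and "A \<subseteq> S2"
  defines "x \<equiv> \<lambda>j k. \<Sum>a\<in>A. cnj (c a) * spherical_harmonic j k a"
  shows "(\<lambda>j. \<Sum>k = - int j..int j. \<Sum>k' = - int j..int j. d j k k' * x j k * cnj (x j k'))
    sums (\<Sum>a\<in>A. \<Sum>b\<in>A. K a b * c b * cnj (c a))"
proof -
  have "(\<lambda>j. \<Sum>a\<in>A. \<Sum>b\<in>A. (\<Sum>k = - int j..int j. \<Sum>k' = - int j..int j.
              d j k k' * spherical_harmonic j k a * cnj (spherical_harmonic j k' b)) * c b * cnj (c a))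
    sums (\<Sum>a\<in>A. \<Sum>b\<in>A. K a b * c b * cnj (c a))"
    using \<open>A \<subseteq> S2\<close> by (intro sums_sum sums_mult2 sums) auto
  moreover have "(\<Sum>a\<in>A. \<Sum>b\<in>A. (\<Sum>k = - int j..int j. \<Sum>k' = - int j..int j.
              d j k k' * spherical_harmonic j k a * cnj (spherical_harmonic j k' b)) * c b * cnj (c a))
      = (\<Sum>k = - int j..int j. \<Sum>k' = - int j..int j. d j k k' * x j k * cnj (x j k'))" for j
  proof -
    let ?J = "{- int j..int j}"
    let ?t = "\<lambda>a b k k'. d j k k' * spherical_harmonic j k a * cnj (spherical_harmonic j k' b) * c b * cnj (c a)"
    have "(\<Sum>a\<in>A. \<Sum>b\<in>A. \<Sum>k\<in>?J. \<Sum>k'\<in>?J. ?t a b k k') = (\<Sum>a\<in>A. \<Sum>k\<in>?J. \<Sum>b\<in>A. \<Sum>k'\<in>?J. ?t a b k k')"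
      by (intro sum.cong refl sum.swap)
    also have "\<dots> = (\<Sum>k\<in>?J. \<Sum>a\<in>A. \<Sum>b\<in>A. \<Sum>k'\<in>?J. ?t a b k k')"
      by (rule sum.swap)
    also have "\<dots> = (\<Sum>k\<in>?J. \<Sum>a\<in>A. \<Sum>k'\<in>?J. \<Sum>b\<in>A. ?t a b k k')"
      by (intro sum.cong refl sum.swap)
    also have "\<dots> = (\<Sum>k\<in>?J. \<Sum>k'\<in>?J. \<Sum>a\<in>A. \<Sum>b\<in>A. ?t a b k k')"
      by (intro sum.cong refl sum.swap)
    also have "\<dots> = (\<Sum>k\<in>?J. \<Sum>k'\<in>?J. d j k k' * x j k * cnj (x j k'))"
      by (intro sum.cong refl) (simp add: x_def sum_product sum_distrib_left mult_ac)
    finally show ?thesis by (simp add: sum_distrib_right)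
  qed
  ultimately show ?thesis by simp
qed


theorem theorem3:
  fixes K :: "real^3 \<Rightarrow> real^3 \<Rightarrow> complex"
    and d :: "nat \<Rightarrow> int \<Rightarrow> int \<Rightarrow> complex"
  assumes "continuous_on (S2 \<times> S2) (\<lambda>(\<xi>, \<zeta>). K \<xi> \<zeta>)"
    and "hermitian_kernel_on S2 K"
    and "\<And>j j' k k'. k \<in> {- int j..int j} \<Longrightarrow> k' \<in> {- int j'..int j'} \<Longrightarrow>
           kernel_coeff K j j' k k' = (if j = j' then d j k k' else 0)"
    and "\<And>\<xi> \<zeta>. \<xi> \<in> S2 \<Longrightarrow> \<zeta> \<in> S2 \<Longrightarrow>
           (\<lambda>j. \<Sum>k = - int j..int j. \<Sum>k' = - int j..int j.
              d j k k' * spherical_harmonic j k \<xi> * cnj (spherical_harmonic j k' \<zeta>))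
           sums K \<xi> \<zeta>"
  shows "positive_definite_on S2 K \<longleftrightarrow> (\<forall>j. positive_operator (2 * j + 1) (block_operator d j))"
proof -
  note K = assms(1) and herm = assms(2) and coeff = assms(3) and series = assms(4)
  interpret finite_measure surface_measure by (rule finite_surface_measure)
  interpret compact_kernel surface_measure S2 K
    by unfold_locales (auto simp: sets_surface_measure K)
  show ?thesis
    unfolding positive_definite_on_iff_form_nonneg[OF herm] positive_block_operator_iff_form_nonneg
  proof (intro iffI allI impI; (elim conjE)?)
    fix j and x :: "int \<Rightarrow> complex"
    let ?J = "{- int j..int j}"
    let ?f = "\<lambda>\<xi>. \<Sum>k\<in>?J. cnj (x k) * spherical_harmonic j k \<xi>"
    assume "\<forall>A c. finite A \<and> A \<subseteq> S2 \<longrightarrow> 0 \<le> (\<Sum>a\<in>A. \<Sum>b\<in>A. K a b * c b * cnj (c a))"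
    then have "0 \<le> (LINT (\<xi>, \<zeta>) | (surface_measure \<Otimes>\<^sub>M surface_measure). K \<xi> \<zeta> * (cnj (?f \<xi>) * ?f \<zeta>))"
      by (intro form_integral_nonneg Bochner_Integration.integrable_sum integrable_mult_right
            integrable_spherical_harmonic) blast
    also have "\<dots> = (\<Sum>k\<in>?J. \<Sum>k'\<in>?J. kernel_coeff K j j k k' * x k * cnj (x k'))"
      by (rule block_form_eq_integral[OF K, symmetric])
    also have "\<dots> = (\<Sum>k\<in>?J. \<Sum>k'\<in>?J. d j k k' * x k * cnj (x k'))"
      by (intro sum.cong refl) (simp add: coeff)
    finally show "0 \<le> (\<Sum>k\<in>?J. \<Sum>k'\<in>?J. d j k k' * x k * cnj (x k'))" .
  next
    fix A :: "(real^3) set" and c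
    assume form: "\<forall>j x. 0 \<le> (\<Sum>k = - int j..int j. \<Sum>k' = - int j..int j. d j k k' * x k * cnj (x k'))"
      and "A \<subseteq> S2"
    have "(\<lambda>j. \<Sum>k = - int j..int j. \<Sum>k' = - int j..int j. d j k k' *
        (\<Sum>a\<in>A. cnj (c a) * spherical_harmonic j k a) *
        cnj (\<Sum>a\<in>A. cnj (c a) * spherical_harmonic j k' a))
      sums (\<Sum>a\<in>A. \<Sum>b\<in>A. K a b * c b * cnj (c a))"
      using series \<open>A \<subseteq> S2\<close> by (rule form_sums_block_forms)
    then show "0 \<le> (\<Sum>a\<in>A. \<Sum>b\<in>A. K a b * c b * cnj (c a))"
      unfolding sums_def
      by (rule tendsto_nonneg_complex) (rule sum_nonneg, rule form[rule_format])
  qed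
qed

end
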